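(* Let $k$ be an algebraically closed field of characteristic $0$, let $t\neq 0$ be an integer, and let $h$ be a nonzero skew-primitive element of $H=F(t)$. Then $\deg_y h\le 1$. Moreover: (i) If $\deg_y h=0$, i.e. $h$ is a (Laurent) polynomial in $x^{\pm1}$, then $h=\lambda x^a(x^m-1)$ for some $\lambda\in k^{\times}$, $a\in\mathbb{Z}$ and some positive integer $m$. (ii) If $\deg_y h=1$, then $h=f+\lambda x^a(x^t-1)$ for some $\lambda\in k$, $a\in\mathbb{Z}$ and some $f\in H$ that is homogeneous with $\deg f=(a,1)$.
   Context: For an integer $t$, $F(t)$ is the algebra $k\langle x^{\pm1},y\rangle$ with relations $xx^{-1}=x^{-1}x=1$ only, with Hopf structure $\Delta(x)=x\otimes x$, $\Delta(y)=y\otimes 1+x^t\otimes y$, $S(x)=x^{-1}$, $S(y)=-x^{-t}y$, $\epsilon(x)=1$, $\epsilon(y)=0$. The $y$-grading is the algebra grading with $\deg_y y=1$, $\deg_y x^{\pm1}=0$; the $x$-grading is the algebra grading with $\deg_x x^{\pm1}=\pm1$, $\deg_x y=0$. Together they give a $(\mathbb{Z}\times\mathbb{N})$-grading, with $\deg h=(\deg_x h,\deg_y h)$ for homogeneous $h$. For a general nonzero $h$, $\deg_y h$ is the largest $n$ such that the $y$-degree-$n$ component of $h$ is nonzero. An element $h$ is skew-primitive if there are group-like elements $g_1,g_2$ with $\Delta(h)=h\otimes g_1+g_2\otimes h$. *)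

theory Defs
  imports
    "HOL-Computational_Algebra.Computational_Algebra"
    "HOL-Library.Poly_Mapping"
    "HOL-Library.Product_Plus"
begin

section \<open>The free algebra on an invertible generator x and a generator y\<close>

text \<open>
  The words in x, its inverse and y, modulo the relations that make x invertible, form the free
  product of the group of integers and the monoid of natural numbers. Each element is uniquely
  of the form \<open>x^a\<^sub>0 y x^a\<^sub>1 y \<dots> y x^a\<^sub>n\<close>: \<open>XPow a\<close> is \<open>x^a\<close> and \<open>XPowY a w\<close>
  is \<open>x^a y w\<close>. The monoid is written additively because the convolution product on
  \<open>_ \<Rightarrow>\<^sub>0 _\<close> requires this; it is not commutative.
\<close>

datatype xy_word = XPow int | XPowY int xy_word

instantiation xy_word :: monoid_add
begin

primrec xshift :: "int \<Rightarrow> xy_word \<Rightarrow> xy_word" where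
  "xshift a (XPow b) = XPow (a + b)"
| "xshift a (XPowY b w) = XPowY (a + b) w"

primrec plus_xy_word :: "xy_word \<Rightarrow> xy_word \<Rightarrow> xy_word" where
  "XPow a + v = xshift a v"
| "XPowY a u + v = XPowY a (u + v)"

definition zero_xy_word :: xy_word where
  "0 = XPow 0"

instance
proof
  have shift0: "xshift 0 w = w" for w
    by (cases w) auto
  have shift_shift: "xshift a (xshift b w) = xshift (a + b) w" for a b w
    by (cases w) auto
  have shift_plus: "xshift a (v + w) = xshift a v + w" for a v w
    by (cases v) (auto simp: shift_shift)
  fix u v w :: xy_word
  show "u + v + w = u + (v + w)"
    by (induction u) (auto simp: shift_plus)
  show "0 + w = w"
    by (simp add: zero_xy_word_def shift0)
  show "w + 0 = w"
    by (induction w) (auto simp: zero_xy_word_def)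
qed

end

text \<open>
  The algebra is the monoid algebra of \<open>xy_word\<close>; that it is presented by \<open>x\<close>,
  \<open>x\<inverse>\<close>, \<open>y\<close> subject only to \<open>x x\<inverse> = x\<inverse> x = 1\<close>
  is the universal property \<open>algebra_hom_lift\<close>, \<open>lift_gens\<close>, \<open>lift_unique\<close> below.
  The algebra does not depend on \<open>t\<close>; only the comultiplication does.
\<close>

type_synonym 'k F = "xy_word \<Rightarrow>\<^sub>0 'k"

definition scalar :: "'k \<Rightarrow> 'm::zero \<Rightarrow>\<^sub>0 'k::zero" where
  "scalar c = Poly_Mapping.single 0 c"

definition xpow :: "int \<Rightarrow> 'k::comm_ring_1 F" where
  "xpow a = Poly_Mapping.single (XPow a) 1"

definition gen_y :: "'k::comm_ring_1 F" where
  "gen_y = Poly_Mapping.single (XPowY 0 (XPow 0)) 1"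

text \<open>Integer powers of \<open>u\<close>, given an inverse \<open>u'\<close>.\<close>

definition zpow :: "'a::ring_1 \<Rightarrow> 'a \<Rightarrow> int \<Rightarrow> 'a" where
  "zpow u u' n = (if n \<ge> 0 then u ^ nat n else u' ^ nat (- n))"

primrec eval_word :: "'a::ring_1 \<Rightarrow> 'a \<Rightarrow> 'a \<Rightarrow> xy_word \<Rightarrow> 'a" where
  "eval_word u u' v (XPow a) = zpow u u' a"
| "eval_word u u' v (XPowY a w) = zpow u u' a * v * eval_word u u' v w"

text \<open>
  The algebra homomorphism determined by \<open>x \<mapsto> u\<close>, \<open>x\<inverse> \<mapsto> u'\<close>,
  \<open>y \<mapsto> v\<close>, where \<open>\<phi>\<close> is the structure map of the target algebra.
\<close>

definition lift :: "('k::comm_ring_1 \<Rightarrow> 'a::ring_1) \<Rightarrow> 'a \<Rightarrow> 'a \<Rightarrow> 'a \<Rightarrow> 'k F \<Rightarrow> 'a" where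
  "lift \<phi> u u' v h =
     (\<Sum>w\<in>Poly_Mapping.keys h. \<phi> (Poly_Mapping.lookup h w) * eval_word u u' v w)"

definition structure_map :: "('k::comm_ring_1 \<Rightarrow> 'a::ring_1) \<Rightarrow> bool" where
  "structure_map \<phi> \<longleftrightarrow> \<phi> 1 = 1 \<and> (\<forall>c d. \<phi> (c + d) = \<phi> c + \<phi> d) \<and>
     (\<forall>c d. \<phi> (c * d) = \<phi> c * \<phi> d) \<and> (\<forall>c z. \<phi> c * z = z * \<phi> c)"

definition algebra_hom :: "('k::comm_ring_1 \<Rightarrow> 'a::ring_1) \<Rightarrow> ('k F \<Rightarrow> 'a) \<Rightarrow> bool" where
  "algebra_hom \<phi> f \<longleftrightarrow> (\<forall>p q. f (p + q) = f p + f q) \<and>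
     (\<forall>p q. f (p * q) = f p * f q) \<and> (\<forall>c. f (scalar c) = \<phi> c)"


section \<open>The Hopf structure\<close>

text \<open>
  Pairs of words index the basis of pure tensors of words (\<open>lookup_tensor\<close>), and
  the convolution product over the product monoid is the usual product on the tensor square
  (\<open>tensor_mult\<close>).
\<close>

type_synonym 'k FF = "(xy_word \<times> xy_word) \<Rightarrow>\<^sub>0 'k"

definition tensor :: "'k::comm_ring_1 F \<Rightarrow> 'k F \<Rightarrow> 'k FF"  (infixr "\<otimes>" 75) where
  "p \<otimes> q = (\<Sum>v\<in>Poly_Mapping.keys p. \<Sum>w\<in>Poly_Mapping.keys q.
     Poly_Mapping.single (v, w) (Poly_Mapping.lookup p v * Poly_Mapping.lookup q w))"

definition comult :: "int \<Rightarrow> 'k::comm_ring_1 F \<Rightarrow> 'k FF" where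
  "comult t = lift scalar (xpow 1 \<otimes> xpow 1) (xpow (- 1) \<otimes> xpow (- 1))
     (gen_y \<otimes> 1 + xpow t \<otimes> gen_y)"

definition counit :: "'k::comm_ring_1 F \<Rightarrow> 'k" where
  "counit = lift id 1 1 0"

definition group_like :: "int \<Rightarrow> 'k::comm_ring_1 F \<Rightarrow> bool" where
  "group_like t g \<longleftrightarrow> comult t g = g \<otimes> g \<and> counit g = 1"

definition skew_primitive :: "int \<Rightarrow> 'k::comm_ring_1 F \<Rightarrow> bool" where
  "skew_primitive t h \<longleftrightarrow> (\<exists>g\<^sub>1 g\<^sub>2. group_like t g\<^sub>1 \<and> group_like t g\<^sub>2 \<and>
     comult t h = h \<otimes> g\<^sub>1 + g\<^sub>2 \<otimes> h)"


section \<open>Gradings\<close>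

primrec xdeg_word :: "xy_word \<Rightarrow> int" where
  "xdeg_word (XPow a) = a"
| "xdeg_word (XPowY a w) = a + xdeg_word w"

primrec ydeg_word :: "xy_word \<Rightarrow> nat" where
  "ydeg_word (XPow a) = 0"
| "ydeg_word (XPowY a w) = Suc (ydeg_word w)"

definition y_component :: "nat \<Rightarrow> 'k::comm_ring_1 F \<Rightarrow> 'k F" where
  "y_component n h = (\<Sum>w | w \<in> Poly_Mapping.keys h \<and> ydeg_word w = n.
     Poly_Mapping.single w (Poly_Mapping.lookup h w))"

text \<open>Meaningful for \<open>h \<noteq> 0\<close> only.\<close>

definition deg_y :: "'k::comm_ring_1 F \<Rightarrow> nat" where
  "deg_y h = Max {n. y_component n h \<noteq> 0}"

definition homogeneous_of_degree :: "int \<times> nat \<Rightarrow> 'k::comm_ring_1 F \<Rightarrow> bool" where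
  "homogeneous_of_degree d f \<longleftrightarrow>
     f \<noteq> 0 \<and> (\<forall>w\<in>Poly_Mapping.keys f. (xdeg_word w, ydeg_word w) = d)"


section \<open>The universal property\<close>

lemma zpow_plus1:
  assumes "u' * u = 1"
  shows "zpow u u' (n + 1) = zpow u u' n * u"
proof (cases "n \<ge> 0")
  case True
  then have "nat (n + 1) = Suc (nat n)" by simp
  with True show ?thesis by (simp add: zpow_def power_commutes)
next
  case False
  then have "nat (- n) = Suc (nat (- (n + 1)))" by simp
  then have "u' ^ nat (- n) * u = u' ^ nat (- (n + 1)) * (u' * u)"
    by (simp add: power_Suc2 mult.assoc del: power_Suc)
  with False assms show ?thesis by (auto simp: zpow_def)
qed

lemma zpow_add:
  assumes "u * u' = 1" "u' * u = 1"
  shows "zpow u u' (m + n) = zpow u u' m * zpow u u' n"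
proof (induction n rule: int_induct[where k = 0])
  case base
  show ?case by (simp add: zpow_def)
next
  case (step1 i)
  have "zpow u u' (m + (i + 1)) = zpow u u' (m + i + 1)"
    by (simp add: add.assoc)
  with step1 show ?case
    using assms by (simp add: zpow_plus1 mult.assoc)
next
  case (step2 i)
  have minus1: "zpow u u' (j - 1) = zpow u u' j * u'" for j
    using zpow_plus1[of u' u "j - 1"] assms by (simp add: mult.assoc)
  have "zpow u u' (m + (i - 1)) = zpow u u' (m + i - 1)"
    by (simp add: algebra_simps)
  then show ?case
    using step2 by (simp add: minus1 mult.assoc)
qed

lemma eval_word_add:
  assumes "u * u' = 1" "u' * u = 1"
  shows "eval_word u u' v (p + q) = eval_word u u' v p * eval_word u u' v q"
proof (induction p)
  case (XPow a)
  show ?case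
    by (cases q) (auto simp: zpow_add[OF assms] mult.assoc)
qed (auto simp: mult.assoc)

lemma single_induct [case_names zero add_single]:
  assumes "P 0"
    and "\<And>w c p. P p \<Longrightarrow> P (p + Poly_Mapping.single w c)"
  shows "P (p :: 'm \<Rightarrow>\<^sub>0 'k::comm_monoid_add)"
proof (induction p rule: update_induct)
  case const
  show ?case by (fact assms(1))
next
  case (update p w c)
  have "Poly_Mapping.update w c p = p + Poly_Mapping.single w c"
    using update.hyps(1)
    by (intro poly_mapping_eqI)
      (auto simp: lookup_update lookup_add lookup_single in_keys_iff when_def)
  with update show ?case using assms(2) by simp
qed

lemma structure_map_simps:
  assumes "structure_map \<phi>"
  shows "\<phi> 1 = 1" "\<phi> (c + d) = \<phi> c + \<phi> d" "\<phi> (c * d) = \<phi> c * \<phi> d"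
  using assms unfolding structure_map_def by blast+

lemma structure_map_commute: "structure_map \<phi> \<Longrightarrow> \<phi> c * z = z * \<phi> c"
  unfolding structure_map_def by blast

lemma lift_zero: "lift \<phi> u u' v 0 = 0"
  by (simp add: lift_def)

lemma lift_superset:
  assumes "structure_map \<phi>" "finite S" "Poly_Mapping.keys h \<subseteq> S"
  shows "lift \<phi> u u' v h = (\<Sum>w\<in>S. \<phi> (Poly_Mapping.lookup h w) * eval_word u u' v w)"
proof -
  have "\<phi> 0 + \<phi> 0 = \<phi> 0"
    using structure_map_simps(2)[OF assms(1), of 0 0] by simp
  then show ?thesis
    unfolding lift_def using assms(2,3)
    by (intro sum.mono_neutral_left) (auto simp: in_keys_iff)
qed

lemma lift_add:
  assumes "structure_map \<phi>"
  shows "lift \<phi> u u' v (p + q) = lift \<phi> u u' v p + lift \<phi> u u' v q"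
proof -
  let ?S = "Poly_Mapping.keys p \<union> Poly_Mapping.keys q"
  have "Poly_Mapping.keys (p + q) \<subseteq> ?S"
    by (rule keys_add)
  then show ?thesis
    using assms
    by (simp add: lift_superset[of \<phi> ?S] lookup_add structure_map_simps[OF assms] distrib_right sum.distrib)
qed

lemma lift_single:
  assumes "structure_map \<phi>"
  shows "lift \<phi> u u' v (Poly_Mapping.single w c) = \<phi> c * eval_word u u' v w"
  using assms by (simp add: lift_superset[of \<phi> "{w}"])

lemma lift_mult:
  assumes \<phi>: "structure_map \<phi>" and "u * u' = 1" "u' * u = 1"
  shows "lift \<phi> u u' v (p * q) = lift \<phi> u u' v p * lift \<phi> u u' v q"
proof (induction p rule: single_induct)
  case zero
  show ?case by (simp add: lift_zero)
next
  case (add_single a c p)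
  have "lift \<phi> u u' v (Poly_Mapping.single a c * q) = \<phi> c * eval_word u u' v a * lift \<phi> u u' v q"
  proof (induction q rule: single_induct)
    case zero
    show ?case by (simp add: lift_zero)
  next
    case (add_single b d q)
    have "\<phi> d * eval_word u u' v a = eval_word u u' v a * \<phi> d"
      by (rule structure_map_commute[OF \<phi>])
    then have "\<phi> c * (\<phi> d * (eval_word u u' v a * eval_word u u' v b)) =
        \<phi> c * (eval_word u u' v a * (\<phi> d * eval_word u u' v b))"
      by (metis mult.assoc)
    moreover have "\<phi> (c * d) = \<phi> c * \<phi> d"
      by (rule structure_map_simps(3)[OF \<phi>])
    ultimately show ?case
      using add_single
      by (simp add: distrib_left mult_single lift_add[OF \<phi>] lift_single[OF \<phi>]
          eval_word_add[OF assms(2,3)] mult.assoc)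
  qed
  with add_single show ?case
    by (simp add: distrib_right lift_add[OF \<phi>] lift_single[OF \<phi>])
qed

theorem algebra_hom_lift:
  assumes "structure_map \<phi>" "u * u' = 1" "u' * u = 1"
  shows "algebra_hom \<phi> (lift \<phi> u u' v)"
  using assms
  by (auto simp: algebra_hom_def lift_add[OF assms(1)] lift_mult[OF assms] scalar_def
      lift_single[OF assms(1)] zero_xy_word_def zpow_def)

theorem lift_gens:
  assumes "structure_map \<phi>"
  shows "lift \<phi> u u' v (xpow 1) = u" "lift \<phi> u u' v (xpow (- 1)) = u'" "lift \<phi> u u' v gen_y = v"
  using assms by (auto simp: xpow_def gen_y_def lift_single zpow_def structure_map_simps[OF assms])

lemma xpow_0: "xpow 0 = 1"
  by (simp add: xpow_def zero_xy_word_def flip: single_one)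

lemma xpow_add: "xpow (a + b) = xpow a * xpow b"
  by (simp add: xpow_def mult_single)

lemma xpow_eq_zpow: "xpow a = zpow (xpow 1 :: 'k::comm_ring_1 F) (xpow (- 1)) a"
proof -
  have "xpow (int n * b) = (xpow b ^ n :: 'k F)" for n b
  proof (induction n)
    case 0
    show ?case by (simp add: xpow_0)
  next
    case (Suc n)
    have "xpow (int (Suc n) * b) = (xpow b * xpow (int n * b) :: 'k F)"
      by (simp add: distrib_right flip: xpow_add)
    with Suc show ?case by simp
  qed
  from this[of "nat a" 1] this[of "nat (- a)" "- 1"] show ?thesis
    by (auto simp: zpow_def)
qed

theorem lift_unique:
  fixes f :: "'k::comm_ring_1 F \<Rightarrow> 'a::ring_1"
  assumes f: "algebra_hom \<phi> f" and \<phi>: "structure_map \<phi>"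
    and u: "f (xpow 1) = u" "f (xpow (- 1)) = u'" "f gen_y = v"
  shows "f = lift \<phi> u u' v"
proof
  have add: "f (p + q) = f p + f q" and mult: "f (p * q) = f p * f q"
    and sc: "f (scalar c) = \<phi> c" for p q c
    using f by (auto simp: algebra_hom_def)
  have one: "f 1 = 1"
    using sc[of 1] by (simp add: scalar_def structure_map_simps(1)[OF \<phi>])
  have pow: "f (p ^ n) = f p ^ n" for p n
    by (induction n) (auto simp: one mult)
  have xp: "f (xpow a) = zpow u u' a" for a
    by (subst xpow_eq_zpow) (auto simp: zpow_def pow u)
  have word: "f (Poly_Mapping.single w 1) = eval_word u u' v w" for w
  proof (induction w)
    case (XPow a)
    show ?case using xp[of a] by (simp add: xpow_def)
  next
    case (XPowY a w)
    have "xshift 0 w = w" by (cases w) auto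
    then have "Poly_Mapping.single (XPowY a w) (1 :: 'k) = xpow a * gen_y * Poly_Mapping.single w 1"
      by (simp add: xpow_def gen_y_def mult_single)
    with XPowY show ?case by (simp add: mult xp u)
  qed
  have zero: "f 0 = 0"
    using add[of 0 0] by simp
  fix h
  show "f h = lift \<phi> u u' v h"
  proof (induction h rule: single_induct)
    case zero
    show ?case by (simp add: lift_zero \<open>f 0 = 0\<close>)
  next
    case (add_single w c p)
    have "Poly_Mapping.single w c = scalar c * Poly_Mapping.single w 1"
      by (simp add: scalar_def mult_single)
    then have "f (Poly_Mapping.single w c) = \<phi> c * eval_word u u' v w"
      by (simp add: mult sc word)
    with add_single show ?case
      by (simp add: add lift_add[OF \<phi>] lift_single[OF \<phi>])
  qed
qed


section \<open>The tensor square and the comultiplication\<close>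

lemma lookup_tensor:
  "Poly_Mapping.lookup (p \<otimes> q) (v, w) = Poly_Mapping.lookup p v * Poly_Mapping.lookup q w"
proof -
  have "Poly_Mapping.lookup (p \<otimes> q) (v, w) =
      (\<Sum>v'\<in>Poly_Mapping.keys p. \<Sum>w'\<in>Poly_Mapping.keys q.
        if v' = v then (if w' = w then Poly_Mapping.lookup p v' * Poly_Mapping.lookup q w' else 0) else 0)"
    by (auto simp: tensor_def lookup_sum lookup_single when_def intro!: sum.cong)
  also have "\<dots> = (\<Sum>v'\<in>Poly_Mapping.keys p. if v' = v then
      (\<Sum>w'\<in>Poly_Mapping.keys q. if w' = w then Poly_Mapping.lookup p v' * Poly_Mapping.lookup q w' else 0) else 0)"
    by (intro sum.cong) auto
  also have "\<dots> = Poly_Mapping.lookup p v * Poly_Mapping.lookup q w"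
    by (simp add: in_keys_iff)
  finally show ?thesis .
qed

lemma tensor_add_left: "(p + p') \<otimes> q = p \<otimes> q + p' \<otimes> q"
  by (rule poly_mapping_eqI) (auto simp: lookup_tensor lookup_add distrib_right)

lemma tensor_add_right: "p \<otimes> (q + q') = p \<otimes> q + p \<otimes> q'"
  by (rule poly_mapping_eqI) (auto simp: lookup_tensor lookup_add distrib_left)

lemma tensor_zero: "0 \<otimes> q = 0" "p \<otimes> 0 = 0"
  by (auto simp: tensor_def)

lemma tensor_single:
  "Poly_Mapping.single v a \<otimes> Poly_Mapping.single w b = Poly_Mapping.single (v, w) (a * b)"
proof (rule poly_mapping_eqI)
  fix z :: "xy_word \<times> xy_word"
  obtain p q where z: "z = (p, q)" by (cases z)
  show "Poly_Mapping.lookup (Poly_Mapping.single v a \<otimes> Poly_Mapping.single w b) z =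
      Poly_Mapping.lookup (Poly_Mapping.single (v, w) (a * b)) z"
    unfolding z lookup_tensor by (cases "v = p"; cases "w = q") (simp_all add: lookup_single)
qed

lemma tensor_one: "1 \<otimes> 1 = 1"
  by (simp add: tensor_single zero_prod_def flip: single_one)

lemma tensor_mult: "(p \<otimes> q) * (p' \<otimes> q') = (p * p') \<otimes> (q * q')"
proof (induction p rule: single_induct)
  case (add_single a c p)
  have "(Poly_Mapping.single a c \<otimes> q) * (p' \<otimes> q') = (Poly_Mapping.single a c * p') \<otimes> (q * q')"
  proof (induction q rule: single_induct)
    case (add_single b d q)
    have "(Poly_Mapping.single a c \<otimes> Poly_Mapping.single b d) * (p' \<otimes> q') =
        (Poly_Mapping.single a c * p') \<otimes> (Poly_Mapping.single b d * q')"
    proof (induction p' rule: single_induct)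
      case (add_single a' c' p')
      have "(Poly_Mapping.single a c \<otimes> Poly_Mapping.single b d) * (Poly_Mapping.single a' c' \<otimes> q') =
          (Poly_Mapping.single a c * Poly_Mapping.single a' c') \<otimes> (Poly_Mapping.single b d * q')"
      proof (induction q' rule: single_induct)
        case (add_single b' d' q')
        then show ?case
          by (simp add: tensor_add_right distrib_left tensor_single mult_single mult_ac)
      qed (simp add: tensor_zero)
      with add_single show ?case
        by (simp add: tensor_add_left distrib_left)
    qed (simp add: tensor_zero)
    with add_single show ?case
      by (simp add: tensor_add_right distrib_right)
  qed (simp add: tensor_zero)
  with add_single show ?case
    by (simp add: tensor_add_left distrib_right)
qed (simp add: tensor_zero)

lemma structure_map_scalar:
  "structure_map (scalar :: 'k::comm_ring_1 \<Rightarrow> 'm::monoid_add \<Rightarrow>\<^sub>0 'k)"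
proof -
  have "scalar c * z = z * scalar c" for c and z :: "'m \<Rightarrow>\<^sub>0 'k"
    by (induction z rule: single_induct)
      (auto simp: scalar_def mult_single distrib_left distrib_right mult.commute)
  moreover have "scalar 1 = (1 :: 'm \<Rightarrow>\<^sub>0 'k)"
    and "scalar (c + d) = (scalar c + scalar d :: 'm \<Rightarrow>\<^sub>0 'k)"
    and "scalar (c * d) = (scalar c * scalar d :: 'm \<Rightarrow>\<^sub>0 'k)" for c d
    by (auto simp: scalar_def single_add mult_single)
  ultimately show ?thesis
    unfolding structure_map_def by blast
qed

theorem algebra_hom_comult:
  "algebra_hom scalar (comult t :: 'k::comm_ring_1 F \<Rightarrow> 'k FF)"
proof -
  have "(xpow a \<otimes> xpow a) * (xpow b \<otimes> xpow b) = (1 :: 'k FF)" if "a + b = 0" for a b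
    using that by (simp add: tensor_mult xpow_0 tensor_one flip: xpow_add)
  then show ?thesis
    unfolding comult_def by (intro algebra_hom_lift structure_map_scalar) auto
qed

theorem comult_gens:
  "comult t (xpow 1) = xpow 1 \<otimes> xpow 1"
  "comult t gen_y = gen_y \<otimes> 1 + xpow t \<otimes> gen_y"
  by (simp_all add: comult_def lift_gens structure_map_scalar)

lemma structure_map_id: "structure_map (id :: 'k::comm_ring_1 \<Rightarrow> 'k)"
  by (simp add: structure_map_def mult.commute)

theorem algebra_hom_counit: "algebra_hom id counit"
  unfolding counit_def by (rule algebra_hom_lift) (auto simp: structure_map_id)

theorem counit_gens: "counit (xpow 1) = 1" "counit gen_y = 0"
  by (simp_all add: counit_def lift_gens structure_map_id)


section \<open>The gradings are algebra gradings\<close>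

lemma xdeg_word_add: "xdeg_word (v + w) = xdeg_word v + xdeg_word w"
proof (induction v)
  case (XPow a)
  show ?case by (cases w) auto
qed auto

lemma ydeg_word_add: "ydeg_word (v + w) = ydeg_word v + ydeg_word w"
proof (induction v)
  case (XPow a)
  show ?case by (cases w) auto
qed auto

lemma lookup_y_component:
  "Poly_Mapping.lookup (y_component n h) w = (Poly_Mapping.lookup h w when ydeg_word w = n)"
  by (auto simp: y_component_def lookup_sum lookup_single when_def in_keys_iff)

end

(* Expanding the comultiplication of a word w = x^a0 y x^a1 ... y x^an distributes the letters y over
   the two tensor factors. Group-likes have no y, by comparing top y-degrees, hence are powers of x.
   If w has n >= 2 letters y, a skew-primitive element has no component of y-degree (n-1, 1). The
   moment of w, the sum over its letters y of the x-degree to the left of the letter, adds up in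
   the component where the k-th letter y goes to the right to the moment of w plus (n-k)t. Since t is
   nonzero, the term k = 1 of the word with extremal moment meets no other term, so
   no such word occurs. The cases of y-degree 0 and 1 follow by comparing coefficients. *)

theory Submission
  imports Defs
begin

section \<open>Expansion of the comultiplication\<close>

text \<open>One pure tensor of words for each way of choosing, at every letter y, the summand y
  \<otimes> 1 or x^t \<otimes> y. A list keeps repetitions, which become coefficients: for t = 0 the
  word y y gives y \<otimes> y twice.\<close>

primrec comult_terms :: "int \<Rightarrow> xy_word \<Rightarrow> (xy_word \<times> xy_word) list" where
  "comult_terms t (XPow a) = [(XPow a, XPow a)]"
| "comult_terms t (XPowY a w) =
     map (\<lambda>(u, v). (XPowY a u, xshift a v)) (comult_terms t w) @
     map (\<lambda>(u, v). (xshift (a + t) u, XPowY a v)) (comult_terms t w)"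

lemma xshift_0: "xshift 0 w = w"
  by (cases w) auto

lemma ydeg_word_xshift: "ydeg_word (xshift a w) = ydeg_word w"
  by (cases w) auto

lemma xshift_inject: "xshift a u = xshift a v \<longleftrightarrow> u = v"
  by (cases u; cases v) auto

lemma ydeg_word_eq_0D: "ydeg_word w = 0 \<Longrightarrow> w = XPow (xdeg_word w)"
  by (cases w) auto

lemma single_times_sum_list:
  fixes c :: "'k::comm_ring_1" and l :: "'m::monoid_add list"
  shows "Poly_Mapping.single z 1 * (\<Sum>y\<leftarrow>l. Poly_Mapping.single y c) =
    (\<Sum>y\<leftarrow>map ((+) z) l. Poly_Mapping.single y c)"
  by (induction l) (auto simp: distrib_left mult_single)

lemma eval_word_comult:
  "eval_word (xpow 1 \<otimes> xpow 1) (xpow (- 1) \<otimes> xpow (- 1))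
     (gen_y \<otimes> 1 + xpow t \<otimes> gen_y :: 'k::comm_ring_1 FF) w =
   (\<Sum>z\<leftarrow>comult_terms t w. Poly_Mapping.single z 1)"
proof -
  let ?u = "xpow 1 \<otimes> xpow 1 :: 'k FF" and ?u' = "xpow (- 1) \<otimes> xpow (- 1) :: 'k FF"
  have tensor_power: "(p \<otimes> p) ^ n = p ^ n \<otimes> p ^ n" for p :: "'k F" and n
    by (induction n) (auto simp: tensor_one tensor_mult)
  have zpow: "zpow ?u ?u' a = Poly_Mapping.single (XPow a, XPow a) 1" for a
  proof -
    have "zpow ?u ?u' a = xpow a \<otimes> xpow a"
      unfolding xpow_eq_zpow[of a] by (simp add: zpow_def tensor_power)
    then show ?thesis
      by (simp add: xpow_def tensor_single)
  qed
  show ?thesis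
  proof (induction w)
    case (XPow a)
    show ?case by (simp add: zpow)
  next
    case (XPowY a w)
    have "Poly_Mapping.single (XPow a, XPow a) 1 * (gen_y \<otimes> 1 + xpow t \<otimes> gen_y :: 'k FF) =
        Poly_Mapping.single (XPowY a (XPow 0), XPow a) 1 + Poly_Mapping.single (XPow (a + t), XPowY a (XPow 0)) 1"
      by (simp add: gen_y_def xpow_def tensor_single mult_single distrib_left zero_xy_word_def
          flip: single_one)
    then show ?case
      by (simp add: XPowY zpow distrib_right single_times_sum_list case_prod_beta plus_prod_def
          xshift_0 comp_def)
  qed
qed

lemma lookup_sum_list_single:
  "Poly_Mapping.lookup (\<Sum>y\<leftarrow>l. Poly_Mapping.single y (1 :: 'k::semiring_1)) z = of_nat (count_list l z)"
  by (induction l) (auto simp: lookup_add lookup_single when_def)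

lemma lookup_scalar_times:
  fixes p :: "'m::monoid_add \<Rightarrow>\<^sub>0 'k::comm_ring_1"
  shows "Poly_Mapping.lookup (scalar c * p) z = c * Poly_Mapping.lookup p z"
  by (induction p rule: single_induct)
    (auto simp: scalar_def distrib_left mult_single lookup_add lookup_single when_def)

lemma lookup_comult:
  "Poly_Mapping.lookup (comult t h) z =
   (\<Sum>w\<in>Poly_Mapping.keys h. Poly_Mapping.lookup h w * of_nat (count_list (comult_terms t w) z))"
  by (simp add: comult_def lift_def lookup_sum lookup_scalar_times eval_word_comult
      lookup_sum_list_single)

text \<open>Without a second word of \<open>h\<close> producing the tensor \<open>z\<close>, nothing
  can cancel, so its coefficient is that of \<open>w\<^sub>0\<close> up to a multiplicity. All later
  coefficient comparisons in positive y-degree go through such tensors.\<close>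

lemma lookup_comult_unique:
  assumes "\<And>w. w \<in> Poly_Mapping.keys h \<Longrightarrow> z \<in> set (comult_terms t w) \<Longrightarrow> w = w\<^sub>0"
  shows "Poly_Mapping.lookup (comult t h) z =
    Poly_Mapping.lookup h w\<^sub>0 * of_nat (count_list (comult_terms t w\<^sub>0) z)"
proof -
  have "Poly_Mapping.lookup (comult t h) z = (\<Sum>w\<in>Poly_Mapping.keys h. if w = w\<^sub>0 then
      Poly_Mapping.lookup h w\<^sub>0 * of_nat (count_list (comult_terms t w\<^sub>0) z) else 0)"
    unfolding lookup_comult
    using assms by (intro sum.cong) (auto, metis count_list_0_iff mult_zero_right of_nat_0)
  then show ?thesis
    by (simp add: in_keys_iff)
qed

section \<open>Distribution of the letters y over the two factors\<close>

lemma set_comult_terms_XPowY: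
  "set (comult_terms t (XPowY a w)) =
     (\<lambda>(u, v). (XPowY a u, xshift a v)) ` set (comult_terms t w) \<union>
     (\<lambda>(u, v). (xshift (a + t) u, XPowY a v)) ` set (comult_terms t w)"
  by simp

lemma comult_terms_XPowY_cases:
  assumes "(u, v) \<in> set (comult_terms t (XPowY a w))"
  obtains (left) u' v' where "(u', v') \<in> set (comult_terms t w)" "u = XPowY a u'" "v = xshift a v'"
    | (right) u' v' where "(u', v') \<in> set (comult_terms t w)" "u = xshift (a + t) u'" "v = XPowY a v'"
  using assms unfolding set_comult_terms_XPowY by fast

lemma comult_terms_ydeg:
  "(u, v) \<in> set (comult_terms t w) \<Longrightarrow> ydeg_word u + ydeg_word v = ydeg_word w"
proof (induction w arbitrary: u v)
  case (XPow a)
  then show ?case by simp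
next
  case (XPowY a w)
  from XPowY.prems show ?case
    by (rule comult_terms_XPowY_cases) (use XPowY.IH in \<open>force simp: ydeg_word_xshift\<close>)+
qed

text \<open>A right factor without y means that every letter y went to the left; the right factor
  then collects all powers of x. The equivalence gives both occurrence and uniqueness of this
  term.\<close>

lemma comult_terms_right_XPow:
  "(u, v) \<in> set (comult_terms t w) \<and> ydeg_word v = 0 \<longleftrightarrow> (u, v) = (w, XPow (xdeg_word w))"
proof (induction w arbitrary: u v)
  case (XPow a)
  then show ?case by auto
next
  case (XPowY a w)
  have "(w, XPow (xdeg_word w)) \<in> set (comult_terms t w)"
    using XPowY.IH by blast
  then have "(XPowY a w, XPow (a + xdeg_word w)) \<in> set (comult_terms t (XPowY a w))"
    unfolding set_comult_terms_XPowY by force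
  moreover have "(u, v) = (XPowY a w, XPow (a + xdeg_word w))"
    if "(u, v) \<in> set (comult_terms t (XPowY a w))" "ydeg_word v = 0"
    using that(1)
  proof (cases rule: comult_terms_XPowY_cases)
    case (left u' v')
    then have "(u', v') = (w, XPow (xdeg_word w))"
      using XPowY.IH that(2) by (metis ydeg_word_xshift)
    with left show ?thesis by simp
  qed (use that(2) in simp)
  ultimately show ?case by (auto simp del: comult_terms.simps)
qed

text \<open>Here every letter y went to the right, and each leaves one x^t in the left factor; hence
  the summand \<open>t * int (ydeg_word w)\<close> in the exponent.\<close>

lemma comult_terms_left_XPow:
  "(u, v) \<in> set (comult_terms t w) \<and> ydeg_word u = 0 \<longleftrightarrow>
   (u, v) = (XPow (xdeg_word w + t * int (ydeg_word w)), w)"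
proof (induction w arbitrary: u v)
  case (XPow a)
  then show ?case by auto
next
  case (XPowY a w)
  let ?e = "xdeg_word w + t * int (ydeg_word w)"
  have e: "xdeg_word (XPowY a w) + t * int (ydeg_word (XPowY a w)) = a + t + ?e"
    by (simp add: algebra_simps)
  have "(XPow ?e, w) \<in> set (comult_terms t w)"
    using XPowY.IH by blast
  then have "(XPow (a + t + ?e), XPowY a w) \<in> set (comult_terms t (XPowY a w))"
    unfolding set_comult_terms_XPowY by force
  moreover have "(u, v) = (XPow (a + t + ?e), XPowY a w)"
    if "(u, v) \<in> set (comult_terms t (XPowY a w))" "ydeg_word u = 0"
    using that(1)
  proof (cases rule: comult_terms_XPowY_cases)
    case (right u' v')
    then have "(u', v') = (XPow ?e, w)"
      using XPowY.IH that(2) by (metis ydeg_word_xshift)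
    with right show ?thesis by simp
  qed (use that(2) in simp)
  ultimately show ?case unfolding e by (auto simp del: comult_terms.simps)
qed

section \<open>Group-like elements\<close>

lemma lookup_comult_XPow_XPow:
  "Poly_Mapping.lookup (comult t h) (XPow a, XPow b) = (Poly_Mapping.lookup h (XPow a) when a = b)"
proof -
  have "w = XPow a" if "(XPow a, XPow b) \<in> set (comult_terms t w)" for w
    using that comult_terms_right_XPow[of "XPow a" "XPow b" t w] by simp
  then show ?thesis
    by (subst lookup_comult_unique[where w\<^sub>0 = "XPow a"]) (auto simp: when_def)
qed

lemma group_like_imp_xpow:
  fixes g :: "'k::idom F"
  assumes "group_like t g"
  obtains a where "g = xpow a"
proof -
  let ?c = "\<lambda>a. Poly_Mapping.lookup g (XPow a)"
  have eq: "Poly_Mapping.lookup (comult t g) (u, v) = Poly_Mapping.lookup g u * Poly_Mapping.lookup g v" for u v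
    using assms by (simp add: group_like_def lookup_tensor)
  have ydeg0: "ydeg_word w = 0" if w: "w \<in> Poly_Mapping.keys g" for w
  proof -
    let ?n = "Max (ydeg_word ` Poly_Mapping.keys g)"
    have le: "ydeg_word v \<le> ?n" if "v \<in> Poly_Mapping.keys g" for v
      using that by (intro Max_ge) auto
    have "?n \<in> ydeg_word ` Poly_Mapping.keys g"
      using w by (intro Max_in) auto
    then obtain z where z: "z \<in> Poly_Mapping.keys g" "ydeg_word z = ?n"
      by auto
    \<comment> \<open>For z of top y-degree n, the tensor z \<otimes> z occurs in g \<otimes> g. The
      comultiplication preserves total y-degree, so some word of \<open>g\<close> has y-degree 2n,
      which forces n = 0.\<close>
    have "Poly_Mapping.lookup (comult t g) (z, z) \<noteq> 0"
      using z by (simp add: eq in_keys_iff)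
    then obtain v where v: "v \<in> Poly_Mapping.keys g" "count_list (comult_terms t v) (z, z) \<noteq> 0"
      unfolding lookup_comult by (metis (no_types, lifting) mult_zero_right of_nat_0 sum.neutral)
    then have "ydeg_word z + ydeg_word z = ydeg_word v"
      by (intro comult_terms_ydeg[where t = t]) (simp add: count_list_0_iff)
    with le[OF v(1)] le[OF w] z(2) show ?thesis by simp
  qed
  have "counit g = 1"
    using assms by (simp add: group_like_def)
  then have "g \<noteq> 0"
    by (auto simp: counit_def lift_zero)
  then obtain w where "w \<in> Poly_Mapping.keys g"
    by (metis keys_eq_empty ex_in_conv)
  with ydeg0 obtain a where a: "?c a \<noteq> 0"
    by (metis in_keys_iff ydeg_word_eq_0D)
  \<comment> \<open>The products for b different from a leave x^a as the only power of x in
    \<open>g\<close>; b = a makes its coefficient a nonzero idempotent, hence 1.\<close>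
  have prod: "?c a * ?c b = (?c a when a = b)" for b
    using eq[of "XPow a" "XPow b"] by (simp add: lookup_comult_XPow_XPow)
  have "Poly_Mapping.lookup g w = Poly_Mapping.lookup (xpow a) w" for w
  proof (cases "ydeg_word w = 0")
    case True
    then obtain b where "w = XPow b"
      by (metis ydeg_word_eq_0D)
    with a prod[of b] show ?thesis
      by (auto simp: xpow_def lookup_single when_def split: if_splits)
  next
    case False
    then have "w \<noteq> XPow a" by auto
    with False ydeg0[of w] show ?thesis
      by (auto simp: xpow_def lookup_single in_keys_iff)
  qed
  then have "g = xpow a"
    by (intro poly_mapping_eqI)
  with that show ?thesis .
qed

section \<open>Skew-primitive elements\<close>

text \<open>The factor \<open>int (ydeg_word w) + 1\<close> counts the letters y of
  \<open>XPowY a w\<close>, all of which have x^a to their left.\<close>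

primrec moment :: "xy_word \<Rightarrow> int" where
  "moment (XPow a) = 0"
| "moment (XPowY a w) = moment w + a * (int (ydeg_word w) + 1)"

lemma moment_xshift: "moment (xshift a w) = moment w + a * int (ydeg_word w)"
  by (cases w) (auto simp: algebra_simps)

text \<open>The single letter y sent to the right keeps the x-degree to its left. In the left factor
  it is replaced by x^t, which adds t for each letter behind it; j is the number of those
  letters.\<close>

lemma comult_terms_right_moment:
  assumes "(u, v) \<in> set (comult_terms t w)" "ydeg_word v = 1"
  shows "\<exists>j<ydeg_word w. moment u + moment v = moment w + t * int j"
  using assms
proof (induction w arbitrary: u v)
  case (XPow a)
  then show ?case by simp
next
  case (XPowY a w)
  show ?case
    using XPowY.prems(1)
  proof (cases rule: comult_terms_XPowY_cases)
    case (left u' v')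
    then have "ydeg_word v' = 1"
      using XPowY.prems(2) by (simp add: ydeg_word_xshift)
    with left(1) XPowY.IH obtain j where j: "j < ydeg_word w" "moment u' + moment v' = moment w + t * int j"
      by blast
    have "int (ydeg_word u') + 1 = int (ydeg_word w)"
      using comult_terms_ydeg[OF left(1)] \<open>ydeg_word v' = 1\<close> by simp
    then have "moment u = moment u' + a * int (ydeg_word w)" "moment v = moment v' + a"
      using left(2,3) \<open>ydeg_word v' = 1\<close> by (simp_all add: moment_xshift)
    with j(2) have "moment u + moment v = moment (XPowY a w) + t * int j"
      by (simp add: distrib_left)
    with j(1) show ?thesis
      by (intro exI[of _ j]) simp
  next
    case (right u' v')
    then have "(u', v') = (w, XPow (xdeg_word w))"
      using XPowY.prems(2) comult_terms_right_XPow[of u' v' t w] by simp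
    \<comment> \<open>The leading letter itself goes to the right, and all letters of
      \<open>w\<close> stand behind it.\<close>
    with right show ?thesis
      by (intro exI[of _ "ydeg_word w"]) (simp add: moment_xshift algebra_simps)
  qed
qed

lemma comult_terms_first_right:
  "(xshift (a + t) w, XPowY a (XPow (xdeg_word w))) \<in> set (comult_terms t (XPowY a w))"
proof -
  have "(w, XPow (xdeg_word w)) \<in> set (comult_terms t w)"
    using comult_terms_right_XPow[of w "XPow (xdeg_word w)" t w] by simp
  then show ?thesis
    unfolding set_comult_terms_XPowY by force
qed

text \<open>If a later letter of \<open>w'\<close> produced the tensor, fewer letters would stand
  behind it, and equality of the moments would make \<open>t * moment w'\<close> exceed the assumed
  bound. If the first letter produced it, the tensor determines \<open>w'\<close>. Multiplying
  moments by t treats both signs of t at once.\<close>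

lemma comult_terms_first_right_unique:
  assumes "t \<noteq> 0" "(xshift (a + t) w, XPowY a (XPow (xdeg_word w))) \<in> set (comult_terms t w')"
    and "t * moment w' \<le> t * moment (XPowY a w)"
  shows "w' = XPowY a w"
proof -
  have ydeg: "ydeg_word w' = Suc (ydeg_word w)"
    using comult_terms_ydeg[OF assms(2)] by (simp add: ydeg_word_xshift)
  then obtain b w'' where w': "w' = XPowY b w''" "ydeg_word w'' = ydeg_word w"
    by (cases w') auto
  show ?thesis
    using assms(2)[unfolded w'(1)]
  proof (cases rule: comult_terms_XPowY_cases)
    case (left u v)
    have "ydeg_word v = 1"
      using arg_cong[OF left(3), of ydeg_word] by (simp add: ydeg_word_xshift)
    then obtain j where j: "j < ydeg_word w" "moment u + moment v = moment w'' + t * int j"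
      using comult_terms_right_moment[OF left(1)] w'(2) by auto
    have "ydeg_word u + ydeg_word v = ydeg_word w"
      using comult_terms_ydeg[OF left(1)] w'(2) by simp
    then have n: "int (ydeg_word w) = int (ydeg_word u) + 1"
      using \<open>ydeg_word v = 1\<close> by simp
    have "moment w + (a + t) * int (ydeg_word w) = moment u + b * (int (ydeg_word u) + 1)"
      using arg_cong[OF left(2), of moment] by (simp add: moment_xshift)
    moreover have "a = moment v + b"
      using arg_cong[OF left(3), of moment] \<open>ydeg_word v = 1\<close> by (simp add: moment_xshift)
    ultimately have "moment (XPowY a w) + t * int (ydeg_word w) = moment w' + t * int j"
      using j(2) n w' by (simp add: algebra_simps)
    then have "t * moment (XPowY a w) + t * t * int (ydeg_word w) = t * moment w' + t * t * int j"
      by (metis distrib_left mult.assoc)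
    moreover have "t * t * int j < t * t * int (ydeg_word w)"
      using assms(1) j(1) by (intro mult_strict_left_mono) (auto simp: zero_less_mult_iff)
    ultimately show ?thesis
      using assms(3) by linarith
  next
    case (right u v)
    then have "v = XPow (xdeg_word w)" "a = b" "u = w"
      by (auto simp: xshift_inject)
    with right(1) w'(1) show ?thesis
      using comult_terms_right_XPow[of u v t w''] by auto
  qed
qed

section \<open>Coefficients of a skew-primitive element\<close>

locale skew_primitive_xpow =
  fixes t :: int and h :: "'k::{idom, ring_char_0} F" and p q :: int
  assumes comult_eq: "comult t h = h \<otimes> xpow p + xpow q \<otimes> h"
begin

lemma lookup_comult_eq:
  "Poly_Mapping.lookup (comult t h) (u, v) =
     (Poly_Mapping.lookup h u when v = XPow p) + (Poly_Mapping.lookup h v when u = XPow q)"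
  by (auto simp: comult_eq lookup_add lookup_tensor xpow_def lookup_single when_def)

lemma ydeg_le_1:
  assumes "t \<noteq> 0" and w: "w \<in> Poly_Mapping.keys h"
  shows "ydeg_word w \<le> 1"
proof (rule ccontr)
  assume "\<not> ydeg_word w \<le> 1"
  \<comment> \<open>Only words of the same y-degree can share a term, so the extremal moment is
    sought within one y-degree.\<close>
  define S where "S = {v \<in> Poly_Mapping.keys h. ydeg_word v = ydeg_word w}"
  have "finite S" "S \<noteq> {}"
    using w by (auto simp: S_def)
  then have "Max ((\<lambda>v. t * moment v) ` S) \<in> (\<lambda>v. t * moment v) ` S"
    by (intro Max_in) auto
  then obtain s where s: "s \<in> S" and "t * moment s = Max ((\<lambda>v. t * moment v) ` S)"
    by auto
  then have max: "t * moment v \<le> t * moment s" if "v \<in> S" for v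
    unfolding \<open>t * moment s = _\<close> using that \<open>finite S\<close> by (intro Max_ge) auto
  obtain a r where r: "s = XPowY a r" "ydeg_word r \<ge> 1"
    using s \<open>\<not> ydeg_word w \<le> 1\<close> by (cases s) (auto simp: S_def)
  define z where "z = (xshift (a + t) r, XPowY a (XPow (xdeg_word r)))"
  have z: "z \<in> set (comult_terms t s)"
    unfolding z_def r(1) by (rule comult_terms_first_right)
  have "v = s" if v: "v \<in> Poly_Mapping.keys h" "z \<in> set (comult_terms t v)" for v
  proof -
    have "ydeg_word v = ydeg_word s"
      using comult_terms_ydeg z v(2) unfolding z_def by metis
    then have "v \<in> S"
      using s v(1) by (simp add: S_def)
    with max v(2) show ?thesis
      unfolding z_def r(1) by (intro comult_terms_first_right_unique[OF assms(1)])
  qed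
  then have "Poly_Mapping.lookup (comult t h) z =
      Poly_Mapping.lookup h s * of_nat (count_list (comult_terms t s) z)"
    by (rule lookup_comult_unique)
  \<comment> \<open>Both factors of \<open>z\<close> contain a letter y, whereas every tensor on the
    right-hand side of \<open>comult_eq\<close> has a power of x as one factor.\<close>
  moreover have "xshift (a + t) r \<noteq> XPow q"
    using r(2) by (cases r) auto
  then have "Poly_Mapping.lookup (comult t h) z = 0"
    by (simp add: z_def lookup_comult_eq)
  \<comment> \<open>The multiplicity of \<open>z\<close> is positive and stays nonzero in
    characteristic 0.\<close>
  ultimately show False
    using s z by (auto simp: S_def in_keys_iff count_list_0_iff)
qed

text \<open>Comparing coefficients of x^a \<otimes> x^a leaves only the exponents p and q, and x^q
  \<otimes> x^p makes their coefficients opposite. For p = q the coefficient equals its own double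
  and vanishes, as does the difference in the statement.\<close>

lemma lookup_XPow:
  "\<exists>c. \<forall>a. Poly_Mapping.lookup h (XPow a) = (c when a = p) - (c when a = q)"
proof -
  have eq: "(Poly_Mapping.lookup h (XPow a) when a = b) =
      (Poly_Mapping.lookup h (XPow a) when b = p) + (Poly_Mapping.lookup h (XPow b) when a = q)" for a b
    using lookup_comult_eq[of "XPow a" "XPow b"] by (simp add: lookup_comult_XPow_XPow)
  have "Poly_Mapping.lookup h (XPow a) =
      (Poly_Mapping.lookup h (XPow p) when a = p) - (Poly_Mapping.lookup h (XPow p) when a = q)" for a
    using eq[of a a] eq[of q p] by (auto simp: when_def add_eq_0_iff split: if_splits)
  then show ?thesis by blast
qed

text \<open>Only \<open>w\<close> yields a term with left factor \<open>w\<close> and a power of x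
  on the right, and this term must lie in h \<otimes> x^p, which fixes p. Symmetrically, the term
  with \<open>w\<close> on the right must lie in x^q \<otimes> h, which fixes q.\<close>

lemma xdeg_of_key:
  assumes "w \<in> Poly_Mapping.keys h" "ydeg_word w > 0"
  shows "xdeg_word w = p" "p + t * int (ydeg_word w) = q"
proof -
  have w: "w \<noteq> XPow b" for b
    using assms(2) by auto
  let ?d = "XPow (xdeg_word w)" and ?e = "XPow (xdeg_word w + t * int (ydeg_word w))"
  have "(w, ?d) \<in> set (comult_terms t w)" "(?e, w) \<in> set (comult_terms t w)"
    using comult_terms_right_XPow[of w ?d t w] comult_terms_left_XPow[of ?e w t w] by auto
  moreover have "Poly_Mapping.lookup (comult t h) (w, ?d) =
      Poly_Mapping.lookup h w * of_nat (count_list (comult_terms t w) (w, ?d))"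
    using comult_terms_right_XPow[of w ?d t] by (intro lookup_comult_unique) auto
  moreover have "Poly_Mapping.lookup (comult t h) (?e, w) =
      Poly_Mapping.lookup h w * of_nat (count_list (comult_terms t w) (?e, w))"
    using comult_terms_left_XPow[of ?e w t] by (intro lookup_comult_unique) auto
  ultimately have "Poly_Mapping.lookup (comult t h) (w, ?d) \<noteq> 0" "Poly_Mapping.lookup (comult t h) (?e, w) \<noteq> 0"
    using assms(1) by (auto simp: in_keys_iff count_list_0_iff)
  then show "xdeg_word w = p" "p + t * int (ydeg_word w) = q"
    using w by (auto simp: lookup_comult_eq when_def split: if_splits)
qed

end

section \<open>Reading off the two cases of the y-degree\<close>

lemma deg_y_eq_Max: "deg_y h = Max (ydeg_word ` Poly_Mapping.keys h)"
proof -
  have "y_component n h \<noteq> 0 \<longleftrightarrow> n \<in> ydeg_word ` Poly_Mapping.keys h" for n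
    by (auto simp: poly_mapping_eq_iff fun_eq_iff lookup_y_component in_keys_iff when_def image_iff)
  then show ?thesis
    by (simp add: deg_y_def)
qed

theorem proposition4p3:
  fixes t :: int and h :: "'k::{alg_closed_field, field_char_0} F"
  assumes "t \<noteq> 0" and "h \<noteq> 0" and "skew_primitive t h"
  shows "deg_y h \<le> 1 \<and>
    (deg_y h = 0 \<longrightarrow>
      (\<exists>c a m. c \<noteq> 0 \<and> m > 0 \<and>
        h = scalar c * xpow a * (xpow m - 1))) \<and>
    (deg_y h = 1 \<longrightarrow>
      (\<exists>c a f. homogeneous_of_degree (a, 1) f \<and>
        h = f + scalar c * xpow a * (xpow t - 1)))"
proof -
  obtain p q where "comult t h = h \<otimes> xpow p + xpow q \<otimes> h"
    using assms(3) unfolding skew_primitive_def by (metis group_like_imp_xpow)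
  then interpret skew_primitive_xpow t h p q
    by unfold_locales
  let ?Y = "ydeg_word ` Poly_Mapping.keys h"
  have Y: "finite ?Y" "?Y \<noteq> {}"
    using assms(2) by auto
  obtain c where c: "\<And>a. Poly_Mapping.lookup h (XPow a) = (c when a = p) - (c when a = q)"
    using lookup_XPow by blast
  have deg_le: "deg_y h \<le> 1"
    using Y ydeg_le_1[OF assms(1)] by (auto simp: deg_y_eq_Max)
  have xpow_diff: "xpow a * (xpow m - 1) = (xpow (a + m) - xpow a :: 'k F)" for a m
    by (simp add: right_diff_distrib xpow_add)
  have scalar_uminus: "scalar (- c) = (- scalar c :: 'k F)"
    by (simp add: scalar_def single_uminus)
  \<comment> \<open>The y-degree is at most 1, and the part of y-degree 0 is known from
    \<open>lookup_XPow\<close>.\<close>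
  have split: "h = y_component 1 h + scalar c * (xpow p - xpow q)"
  proof (rule poly_mapping_eqI)
    fix w
    show "Poly_Mapping.lookup h w = Poly_Mapping.lookup (y_component 1 h + scalar c * (xpow p - xpow q)) w"
    proof (cases w)
      case (XPow a)
      then show ?thesis
        by (simp add: c lookup_add lookup_minus lookup_scalar_times lookup_y_component xpow_def
            lookup_single when_def)
    next
      case (XPowY a v)
      then show ?thesis
        using ydeg_le_1[OF assms(1), of w]
        by (cases "w \<in> Poly_Mapping.keys h")
          (auto simp: lookup_add lookup_minus lookup_scalar_times lookup_y_component xpow_def
            lookup_single in_keys_iff when_def)
    qed
  qed
  have deg0: "\<exists>c a m. c \<noteq> 0 \<and> m > 0 \<and> h = scalar c * xpow a * (xpow m - 1)" if "deg_y h = 0"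
  proof -
    have "ydeg_word w = 0" if "w \<in> Poly_Mapping.keys h" for w
      using \<open>deg_y h = 0\<close> Max_ge[OF Y(1), of "ydeg_word w"] that by (simp add: deg_y_eq_Max)
    then have "y_component 1 h = 0"
      by (intro poly_mapping_eqI) (force simp: lookup_y_component when_def in_keys_iff)
    with split have h: "h = scalar c * (xpow p - xpow q)"
      by simp
    with assms(2) have ne: "c \<noteq> 0" "p \<noteq> q"
      by (auto simp: scalar_def)
    show ?thesis
    \<comment> \<open>The smaller of the two exponents is factored out so that m is positive; the
      sign of \<open>c\<close> changes when this is p.\<close>
    proof (cases "q < p")
      case True
      then have "h = scalar c * xpow q * (xpow (p - q) - 1)"
        by (simp add: h mult.assoc xpow_diff)
      with True ne show ?thesis
        by (intro exI[of _ c] exI[of _ q] exI[of _ "p - q"]) auto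
    next
      case False
      have "h = scalar (- c) * xpow p * (xpow (q - p) - 1)"
        unfolding h mult.assoc xpow_diff by (simp add: scalar_uminus right_diff_distrib)
      with False ne show ?thesis
        by (intro exI[of _ "- c"] exI[of _ p] exI[of _ "q - p"]) auto
    qed
  qed
  have deg1: "\<exists>c a f. homogeneous_of_degree (a, 1) f \<and> h = f + scalar c * xpow a * (xpow t - 1)"
    if "deg_y h = 1"
  proof -
    have "1 \<in> ?Y"
      using Max_in[OF Y] that by (simp add: deg_y_eq_Max)
    then obtain w where w: "w \<in> Poly_Mapping.keys h" "ydeg_word w = 1"
      by auto
    \<comment> \<open>A word with exactly one y ties the two group-likes together: q - p = t turns
      x^p - x^q into - x^p (x^t - 1), and the homogeneous part has x-degree p.\<close>
    then have q: "q = p + t"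
      using xdeg_of_key(2)[of w] by simp
    have "w \<in> Poly_Mapping.keys (y_component 1 h)"
      using w by (simp add: in_keys_iff lookup_y_component)
    then have "y_component 1 h \<noteq> 0"
      by auto
    then have "homogeneous_of_degree (p, 1) (y_component 1 h)"
      using xdeg_of_key(1)
      by (auto simp: homogeneous_of_degree_def in_keys_iff lookup_y_component when_def split: if_splits)
    moreover have "h = y_component 1 h + scalar (- c) * xpow p * (xpow t - 1)"
      using split unfolding q mult.assoc xpow_diff by (simp add: scalar_uminus right_diff_distrib)
    ultimately show ?thesis by blast
  qed
  from deg_le deg0 deg1 show ?thesis by blast
qed

end
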